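(* Let $r\geq 0$, $s\geq 3$, and $k\geq r+2$ be integers, let $d=sk+r$, and let $$q=(q_1,\ldots,q_d)=(\underbrace{1,1,\ldots,1}_{sk-1\text{ times}},\underbrace{s,s,\ldots,s}_{r+1\text{ times}}).$$ Then the lattice $d$-simplex $\Delta_{(1,q)}=\mathrm{conv}(e_1,\ldots,e_d,-q)\subset\mathbb{R}^d$ is Ehrhart positive.
   Context: Here $e_1,\ldots,e_d$ are the standard basis vectors of $\mathbb{R}^d$ and $\mathrm{conv}$ denotes convex hull. For a $d$-dimensional lattice polytope $P\subset\mathbb{R}^n$ (the convex hull of finitely many points of $\mathbb{Z}^n$, with $d$-dimensional affine span) and $t\in\mathbb{Z}_{\geq 0}$, let $tP=\{tp : p\in P\}$ and $i(P;t)=|tP\cap\mathbb{Z}^n|$; this is a polynomial in $t$ of degree $d$ (the Ehrhart polynomial). $P$ is Ehrhart positive if all coefficients (of $t^0,\dots,t^d$) of $i(P;t)$ are positive (strictly greater than $0$). *)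

theory Defs
  imports "HOL-Analysis.Analysis" "HOL-Computational_Algebra.Polynomial"
begin

definition integer_points :: "(real ^ 'n) set" where
  "integer_points = {x. \<forall>i. x $ i \<in> \<int>}"

definition lattice_polytope :: "(real ^ 'n) set \<Rightarrow> bool" where
  "lattice_polytope P \<longleftrightarrow>
     (\<exists>V. finite V \<and> V \<noteq> {} \<and> V \<subseteq> integer_points \<and> P = convex hull V)"

definition lattice_count :: "(real ^ 'n) set \<Rightarrow> nat \<Rightarrow> nat" where
  "lattice_count P t = card ((\<lambda>p. real t *\<^sub>R p) ` P \<inter> integer_points)"

text \<open>
  A polynomial is determined by its values at the natural numbers, so at most one polynomial
  satisfies this predicate.
\<close>

definition is_ehrhart_polynomial :: "(real ^ 'n) set \<Rightarrow> real poly \<Rightarrow> bool" where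
  "is_ehrhart_polynomial P p \<longleftrightarrow>
     int (degree p) = aff_dim P \<and> (\<forall>t. poly p (real t) = real (lattice_count P t))"

definition ehrhart_positive :: "(real ^ 'n) set \<Rightarrow> bool" where
  "ehrhart_positive P \<longleftrightarrow>
     (\<exists>p. is_ehrhart_polynomial P p \<and> (\<forall>i\<le>degree p. coeff p i > 0))"

definition Delta_1 :: "real ^ 'n \<Rightarrow> (real ^ 'n) set" where
  "Delta_1 q = convex hull (range (\<lambda>i. axis i 1) \<union> {- q})"

definition weights :: "nat \<Rightarrow> nat \<Rightarrow> nat \<Rightarrow> nat list" where
  "weights r s k = replicate (s * k - 1) 1 @ replicate (r + 1) s"

text \<open>
  A finite index type carries no order, so an enumeration of the indices says which
  coordinate comes first, second, and so on. List positions start at 0.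
\<close>

definition vec_of_list_along :: "('n \<Rightarrow> nat) \<Rightarrow> nat list \<Rightarrow> real ^ 'n" where
  "vec_of_list_along pos xs = (\<chi> i. real (xs ! pos i))"

end

theory Submission
  imports Defs "HOL-Computational_Algebra.Fundamental_Theorem_Algebra"
begin

text \<open>
  The Ehrhart polynomial of a \<open>d\<close>-dimensional lattice polytope has the form
  \<open>L(t) = \<Sum>\<^sub>j h\<^sub>j binom(t + d - j, d)\<close>, and \<open>h(z) = \<Sum>\<^sub>j h\<^sub>j z^j\<close> is its
  \<open>h*\<close>-polynomial. Two facts are combined.

  The simplex with vertices \<open>e\<^sub>1, \<dots>, e\<^sub>d, -q\<close> has normalized volume
  \<open>Q = 1 + q\<^sub>1 + \<dots> + q\<^sub>d\<close>, and its \<open>h*\<close>-polynomial is \<open>\<Sum>\<^bsub>b < Q\<^esub> z^w(b)\<close> with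
  \<open>w(b) = b - \<Sum>\<^sub>i floor(q\<^sub>i b / Q)\<close> (\<open>lattice_count_Delta_1\<close>). For the weights at hand put
  \<open>m = k + r + 1\<close>, so that \<open>Q = s m\<close>. Writing \<open>b = a m + c\<close> with \<open>c < m\<close> gives
  \<open>w(b) = k a + c\<close>, hence
  \<open>h(z) = (1 + z^k + \<dots> + z^((s - 1) k)) (1 + z + \<dots> + z^(m - 1))\<close>
  (\<open>hstar_weights\<close>). Both factors are geometric sums, in \<open>z^k\<close> and in \<open>z\<close>, so all roots of \<open>h\<close> are
  roots of unity.

  If \<open>h\<close> has no root in the open unit disc, then all roots of \<open>L\<close> have negative real part
  (\<open>binomial_transform_nonzero\<close>). For \<open>h\<close> of degree \<open>e\<close>, \<open>L\<close> has the zeros \<open>-1, \<dots>, -(d - e)\<close>, and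
  the claim is that its other zeros lie in the half-plane \<open>Re t \<le> -(d - e + 1)/2\<close>. For \<open>e = 0\<close> there
  are no others. Splitting off a root \<open>a\<close> of \<open>h\<close> means that \<open>L(t) = f(t - 1) - a f(t)\<close>, where \<open>f\<close>
  belongs to the polynomial \<open>h(z) / (z - a)\<close> of degree \<open>e - 1\<close>. As \<open>\<bar>a\<bar> \<ge> 1\<close>, a zero of \<open>L\<close> forces
  \<open>\<bar>f(t)\<bar> \<le> \<bar>f(t - 1)\<bar>\<close>; once the common factors are cancelled, this is impossible to the right of the
  line that lies \<open>1/2\<close> to the right of the one for \<open>f\<close>.

  A real polynomial with positive leading coefficient and all roots in the open left half-plane
  is a product of a positive constant and factors \<open>x + u\<close> and \<open>x\<^sup>2 + u x + v\<close> with \<open>u, v > 0\<close>, so all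
  its coefficients are positive (\<open>coeff_pos_if_roots_in_left_half_plane\<close>).
\<close>

section \<open>The simplex and its dilations\<close>

lemma sum_UNIV_option:
  fixes f :: "'a::finite option \<Rightarrow> 'b::comm_monoid_add"
  shows "sum f UNIV = f None + (\<Sum>i\<in>UNIV. f (Some i))"
  by (simp add: UNIV_option_conv sum.reindex)

text \<open>
  The barycentric coordinate of \<open>x\<close> at the vertex \<open>-q\<close> is \<open>(1 - \<Sum>x) / (1 + \<Sum>q)\<close>, and the one at
  \<open>e\<^sub>i\<close> is \<open>x\<^sub>i\<close> plus \<open>q\<^sub>i\<close> times it. The inequalities say that these are nonnegative, with the
  denominator \<open>1 + \<Sum>q\<close> cleared.
\<close>

lemma Delta_1_eq:
  fixes q :: "real ^ 'n"
  assumes q: "\<And>i. q $ i \<ge> 0"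
  shows "Delta_1 q = {x. sum (($) x) UNIV \<le> 1 \<and>
           (\<forall>i. 0 \<le> x $ i * (1 + sum (($) q) UNIV) + (1 - sum (($) x) UNIV) * q $ i)}"
    (is "_ = ?H")
proof
  let ?Q = "1 + sum (($) q) UNIV"
  have Q: "?Q > 0"
    using q by (simp add: add_pos_nonneg sum_nonneg)
  have conv: "convex ?H"
  proof (rule convexI)
    fix x y :: "real ^ 'n" and u v :: real
    assume x: "x \<in> ?H" and y: "y \<in> ?H" and uv: "0 \<le> u" "0 \<le> v" "u + v = 1"
    define X Y where "X = sum (($) x) UNIV" and "Y = sum (($) y) UNIV"
    have s: "sum (($) (u *\<^sub>R x + v *\<^sub>R y)) UNIV = u * X + v * Y"
      by (simp add: X_def Y_def sum.distrib sum_distrib_left)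
    have u: "u = 1 - v" using uv by simp
    have "u * X \<le> u * 1" "v * Y \<le> v * 1"
      using x y uv by (intro mult_left_mono; simp add: X_def Y_def)+
    then have "u * X + v * Y \<le> 1" using uv by linarith
    moreover have "0 \<le> (u *\<^sub>R x + v *\<^sub>R y) $ i * ?Q + (1 - (u * X + v * Y)) * q $ i" for i
    proof -
      have "0 \<le> x $ i * ?Q + (1 - X) * q $ i" "0 \<le> y $ i * ?Q + (1 - Y) * q $ i"
        using x y unfolding X_def Y_def by blast+
      then have "0 \<le> u * (x $ i * ?Q + (1 - X) * q $ i) + v * (y $ i * ?Q + (1 - Y) * q $ i)"
        using uv by (metis add_nonneg_nonneg mult_nonneg_nonneg)
      also have "\<dots> = (u *\<^sub>R x + v *\<^sub>R y) $ i * ?Q + (1 - (u * X + v * Y)) * q $ i"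
        unfolding u by (simp add: algebra_simps)
      finally show ?thesis .
    qed
    ultimately show "u *\<^sub>R x + v *\<^sub>R y \<in> ?H"
      unfolding mem_Collect_eq s by blast
  qed
  have "axis j 1 \<in> ?H" for j :: 'n
  proof -
    have "sum (($) (axis j (1::real))) UNIV = 1"
      by (simp add: axis_def)
    then show ?thesis using Q by (auto simp: axis_def)
  qed
  moreover have "- q \<in> ?H"
    using Q q by (auto simp: sum_negf sum_nonneg algebra_simps)
  ultimately show "Delta_1 q \<subseteq> ?H"
    unfolding Delta_1_def by (intro hull_minimal conv) auto
  show "?H \<subseteq> Delta_1 q"
  proof
    fix x assume x: "x \<in> ?H"
    define X where "X = sum (($) x) UNIV"
    define c where "c = (1 - X) / ?Q"
    define l :: "'n option \<Rightarrow> real" where "l = case_option c (\<lambda>i. x $ i + c * q $ i)"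
    define y :: "'n option \<Rightarrow> real ^ 'n" where "y = case_option (- q) (\<lambda>i. axis i 1)"
    have "x $ i + c * q $ i = (x $ i * ?Q + (1 - X) * q $ i) / ?Q" for i
      using Q by (simp add: c_def field_simps)
    then have nn: "l j \<ge> 0" for j
      using x Q by (auto simp: l_def c_def X_def split: option.split)
    have "c * ?Q = 1 - X" using Q by (simp add: c_def)
    then have "sum l UNIV = 1"
      unfolding sum_UNIV_option by (simp add: l_def sum.distrib X_def algebra_simps sum_distrib_left)
    then have "(\<Sum>j\<in>UNIV. l j *\<^sub>R y j) \<in> Delta_1 q"
      unfolding Delta_1_def using nn
      by (intro convex_sum) (auto simp: y_def intro!: hull_inc split: option.split)
    moreover have "(\<Sum>j\<in>UNIV. l j *\<^sub>R y j) = x"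
    proof -
      have "(\<Sum>i\<in>UNIV. (x $ i + c * q $ i) *\<^sub>R axis i 1 $ j) = x $ j + c * q $ j" for j
        by (simp add: axis_def if_distrib cong: if_cong)
      then show ?thesis
        unfolding sum_UNIV_option by (simp add: vec_eq_iff l_def y_def)
    qed
    ultimately show "x \<in> Delta_1 q" by simp
  qed
qed

text \<open>
  The homogenized inequalities also cut out the right set, \<open>{0}\<close>, for \<open>t = 0\<close>: adding those
  indexed by \<open>i\<close> gives \<open>\<Sum>x \<ge> 0\<close>, so \<open>\<Sum>x = 0\<close>, and then every \<open>x\<^sub>i\<close> is nonnegative.
\<close>

lemma dilated_Delta_1_iff:
  fixes q :: "real ^ 'n"
  assumes q: "\<And>i. q $ i \<ge> 0"
  shows "x \<in> (\<lambda>p. real t *\<^sub>R p) ` Delta_1 q \<longleftrightarrow>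
           sum (($) x) UNIV \<le> real t \<and>
           (\<forall>i. 0 \<le> x $ i * (1 + sum (($) q) UNIV) + (real t - sum (($) x) UNIV) * q $ i)"
proof (cases "t = 0")
  case True
  have "axis undefined 1 \<in> Delta_1 q"
    unfolding Delta_1_def by (intro hull_inc) auto
  then have "(\<lambda>p. real t *\<^sub>R p) ` Delta_1 q = {0}"
    using True by auto
  moreover have "x = 0" if X: "sum (($) x) UNIV \<le> 0"
    and h: "\<And>i. 0 \<le> x $ i * (1 + sum (($) q) UNIV) - sum (($) x) UNIV * q $ i"
  proof -
    have "0 \<le> (\<Sum>i\<in>UNIV. x $ i * (1 + sum (($) q) UNIV) - sum (($) x) UNIV * q $ i)"
      by (intro sum_nonneg h)
    also have "\<dots> = sum (($) x) UNIV"
      by (simp add: sum_subtractf flip: sum_distrib_left sum_distrib_right)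
         (simp add: algebra_simps)
    finally have 0: "sum (($) x) UNIV = 0" using X by simp
    have "1 + sum (($) q) UNIV > 0"
      using q by (simp add: add_pos_nonneg sum_nonneg)
    then have "x $ i \<ge> 0" for i
      using h[of i] 0 by (simp add: zero_le_mult_iff)
    then show ?thesis
      using 0 by (simp add: sum_nonneg_eq_0_iff vec_eq_iff)
  qed
  ultimately show ?thesis using True by auto
next
  case False
  then have t: "real t > 0" by simp
  have "x \<in> (\<lambda>p. real t *\<^sub>R p) ` Delta_1 q \<longleftrightarrow> (1 / real t) *\<^sub>R x \<in> Delta_1 q"
    using t by (auto simp: image_iff intro!: bexI[of _ "(1 / real t) *\<^sub>R x"])
  also have "\<dots> \<longleftrightarrow> sum (($) x) UNIV \<le> real t \<and>
      (\<forall>i. 0 \<le> x $ i * (1 + sum (($) q) UNIV) + (real t - sum (($) x) UNIV) * q $ i)"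
  proof -
    have s: "sum (($) ((1 / real t) *\<^sub>R x)) UNIV = sum (($) x) UNIV / real t"
      by (simp add: sum_divide_distrib)
    have "((1 / real t) *\<^sub>R x) $ i * (1 + sum (($) q) UNIV) + (1 - sum (($) x) UNIV / real t) * q $ i
        = (x $ i * (1 + sum (($) q) UNIV) + (real t - sum (($) x) UNIV) * q $ i) / real t" for i
      using t by (simp add: field_simps)
    then show ?thesis
      unfolding Delta_1_eq[OF q] mem_Collect_eq s using t by (simp add: zero_le_divide_iff)
  qed
  finally show ?thesis .
qed

text \<open>
  In an affine dependence \<open>U\<close> of the vertices, coordinate \<open>i\<close> yields \<open>U(e\<^sub>i) = U(-q) q\<^sub>i\<close>. Since the
  values of \<open>U\<close> add up to zero, \<open>U(-q) (1 + \<Sum>q) = 0\<close>, and \<open>U\<close> vanishes.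
\<close>

lemma Delta_1_simplex:
  fixes q :: "real ^ 'n"
  assumes q: "\<And>i. q $ i \<ge> 0"
  shows "int CARD('n) simplex Delta_1 q"
proof -
  let ?C = "insert (- q) (range (\<lambda>i::'n. axis i (1::real)))"
  have nin: "- q \<notin> range (\<lambda>i::'n. axis i (1::real))"
  proof
    assume "- q \<in> range (\<lambda>i::'n. axis i (1::real))"
    then obtain i where "- q = axis i 1" by auto
    then have "- q $ i = 1" by (metis axis_nth vector_uminus_component)
    then show False using q[of i] by simp
  qed
  have inj: "inj (\<lambda>i::'n. axis i (1::real))"
    by (auto simp: inj_def axis_eq_axis)
  have "card ?C = Suc CARD('n)"
    using nin inj by (simp add: card_image)
  moreover have "\<not> affine_dependent ?C"
  proof
    assume "affine_dependent ?C"
    then obtain U where U0: "sum U ?C = 0" and Un: "\<exists>v\<in>?C. U v \<noteq> 0"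
      and Us: "(\<Sum>v\<in>?C. U v *\<^sub>R v) = 0"
      by (subst (asm) affine_dependent_explicit_finite) auto
    have s1: "U (- q) + (\<Sum>i\<in>UNIV. U (axis i 1)) = 0"
      using U0 nin inj by (simp add: sum.reindex)
    have s2: "U (axis i 1) = U (- q) * q $ i" for i
    proof -
      have "0 = (\<Sum>v\<in>?C. U v *\<^sub>R v) $ i" using Us by simp
      also have "\<dots> = - (U (- q) * q $ i) + (\<Sum>j\<in>UNIV. U (axis j 1) * axis j 1 $ i)"
        using nin inj by (simp add: sum.reindex)
      also have "(\<Sum>j\<in>UNIV. U (axis j 1) * axis j 1 $ i) = U (axis i 1)"
        by (simp add: axis_def if_distrib cong: if_cong)
      finally show ?thesis by simp
    qed
    have "U (- q) * (1 + sum (($) q) UNIV) = 0"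
      using s1 unfolding s2 by (simp add: algebra_simps sum_distrib_left)
    moreover have "1 + sum (($) q) UNIV > 0"
      using q by (simp add: add_pos_nonneg sum_nonneg)
    ultimately have "U (- q) = 0" by simp
    then show False using Un s2 by auto
  qed
  ultimately show ?thesis
    unfolding simplex_def Delta_1_def by (intro exI[of _ ?C]) auto
qed

section \<open>Counting lattice points\<close>

text \<open>
  Stars and bars, transferred from lists along an enumeration of the index type.
\<close>

lemma card_functions_with_sum:
  "card {f :: 'a::finite \<Rightarrow> nat. sum f UNIV = N} = (N + CARD('a) - 1) choose N"
proof -
  obtain xs :: "'a list" where xs: "set xs = UNIV" "distinct xs"
    using finite_distinct_list[OF finite[of "UNIV :: 'a set"]] by auto
  have len: "length xs = CARD('a)"
    using xs distinct_card by metis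
  have "bij_betw (\<lambda>f. map f xs) {f :: 'a \<Rightarrow> nat. sum f UNIV = N}
          {l. size l = CARD('a) \<and> sum_list l = N}"
  proof (rule bij_betw_imageI)
    show "inj_on (\<lambda>f. map f xs) {f. sum f UNIV = N}"
      using xs by (auto simp: inj_on_def)
    show "(\<lambda>f. map f xs) ` {f. sum f UNIV = N} = {l. size l = CARD('a) \<and> sum_list l = N}"
    proof (intro equalityI subsetI)
      fix l :: "nat list" assume l: "l \<in> {l. size l = CARD('a) \<and> sum_list l = N}"
      define f where "f = (\<lambda>x. the (map_of (zip xs l) x))"
      have m: "map f xs = l"
        using l len xs by (intro nth_equalityI) (auto simp: f_def map_of_zip_nth)
      then have "sum f UNIV = N"
        using l xs sum_list_distinct_conv_sum_set[of xs f] by auto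
      then show "l \<in> (\<lambda>f. map f xs) ` {f. sum f UNIV = N}" using m by auto
    qed (use len xs in \<open>auto simp: sum_list_distinct_conv_sum_set\<close>)
  qed
  then have "card {f :: 'a \<Rightarrow> nat. sum f UNIV = N} = card {l::nat list. size l = CARD('a) \<and> sum_list l = N}"
    by (rule bij_betw_same_card)
  then show ?thesis by (simp add: card_length_sum_list)
qed

text \<open>
  The generating function \<open>\<Sum>\<^bsub>b < 1 + \<Sum>q\<^esub> z^(hstar_exponent q b)\<close> is the \<open>h*\<close>-polynomial of the
  simplex. The truncated subtraction is a true one by \<open>sum_div_le\<close>.
\<close>

definition hstar_exponent :: "('n::finite \<Rightarrow> nat) \<Rightarrow> nat \<Rightarrow> nat" where
  "hstar_exponent q b = b - (\<Sum>i\<in>UNIV. q i * b div (1 + sum q UNIV))"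

lemma sum_div_le:
  fixes q :: "'n::finite \<Rightarrow> nat"
  shows "(\<Sum>i\<in>UNIV. q i * b div (1 + sum q UNIV)) \<le> b"
proof -
  let ?Q = "1 + sum q UNIV"
  have "(\<Sum>i\<in>UNIV. q i * b div ?Q) * ?Q \<le> (\<Sum>i\<in>UNIV. q i * b)"
    unfolding sum_distrib_right by (intro sum_mono div_times_less_eq_dividend)
  also have "\<dots> \<le> b * ?Q"
    by (simp flip: sum_distrib_right)
  finally show ?thesis
    by (subst (asm) mult_le_cancel2) simp
qed

lemma hstar_exponent_le:
  fixes q :: "'n::finite \<Rightarrow> nat"
  assumes b: "b < 1 + sum q UNIV"
  shows "hstar_exponent q b \<le> CARD('n)"
proof -
  define Q where "Q = 1 + sum q UNIV"
  have Q: "Q > 0" by (simp add: Q_def)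
  define S where "S = (\<Sum>i\<in>UNIV. q i * b div Q)"
  have "q i * b \<le> (q i * b div Q) * Q + Q" for i
    using div_mult_mod_eq[of "q i * b" Q] mod_less_divisor[of Q "q i * b"] Q by linarith
  then have "(\<Sum>i\<in>UNIV. q i * b) \<le> (\<Sum>i\<in>UNIV. (q i * b div Q) * Q + Q)"
    by (intro sum_mono)
  then have "sum q UNIV * b \<le> S * Q + CARD('n) * Q"
    by (simp add: sum.distrib S_def sum_distrib_right)
  then have "Q * b < (S + CARD('n) + 1) * Q"
    using b by (simp add: Q_def algebra_simps)
  then have "b < S + CARD('n) + 1"
    unfolding mult.commute[of Q] by (simp only: mult_less_cancel2)
  then show ?thesis by (simp add: hstar_exponent_def S_def Q_def)
qed

text \<open>
  For an integer point \<open>x\<close> of the dilation by \<open>t\<close> put \<open>N = t - \<Sum>x \<ge> 0\<close> and write \<open>N = a Q + b\<close>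
  with \<open>b < Q\<close>. The remaining inequalities say that \<open>y\<^sub>i = x\<^sub>i + floor(q\<^sub>i N / Q)\<close> is a natural number,
  and \<open>a + \<Sum>y = t - w(b)\<close>. So lattice points correspond to a residue \<open>b\<close> together with
  \<open>d + 1\<close> natural numbers of sum \<open>t - w(b)\<close>. In the proof these numbers form one function \<open>f\<close> on the
  option type: \<open>f None = a\<close> and \<open>f (Some i) = y\<^sub>i\<close>.
\<close>

lemma lattice_count_Delta_1:
  fixes q :: "'n::finite \<Rightarrow> nat"
  shows "lattice_count (Delta_1 (\<chi> i. real (q i))) t =
    (\<Sum>b<1 + sum q UNIV. if hstar_exponent q b \<le> t
       then (t - hstar_exponent q b + CARD('n)) choose CARD('n) else 0)"
proof -
  define Q where "Q = 1 + sum q UNIV"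
  define w where "w = hstar_exponent q"
  have Q: "Q > 0" by (simp add: Q_def)
  define F where "F b = {f :: 'n option \<Rightarrow> nat. w b + sum f UNIV = t}" for b
  define N where "N b f = f None * Q + b" for b and f :: "'n option \<Rightarrow> nat"
  define x :: "nat \<times> ('n option \<Rightarrow> nat) \<Rightarrow> 'n \<Rightarrow> int" where
    "x = (\<lambda>(b, f) i. int (f (Some i)) - int (q i * N b f div Q))"
  define \<phi> :: "nat \<times> ('n option \<Rightarrow> nat) \<Rightarrow> real ^ 'n" where
    "\<phi> = (\<lambda>z. \<chi> i. real_of_int (x z i))"
  define A where "A = (\<lambda>p. real t *\<^sub>R p) ` Delta_1 (\<chi> i. real (q i)) \<inter> integer_points"
  have w: "w b + (\<Sum>i\<in>UNIV. q i * b div Q) = b" for b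
    using sum_div_le[of q b] by (simp add: w_def hstar_exponent_def Q_def)
  have divN: "q i * N b f div Q = q i * f None + q i * b div Q" for b f i
  proof -
    have "q i * N b f = q i * b + q i * f None * Q" by (simp add: N_def algebra_simps)
    then show ?thesis using Q by simp
  qed
  have key: "f None + w b + (\<Sum>i\<in>UNIV. q i * N b f div Q) = N b f" for b f
  proof -
    have "f None + w b + (\<Sum>i\<in>UNIV. q i * N b f div Q)
        = f None + sum q UNIV * f None + (w b + (\<Sum>i\<in>UNIV. q i * b div Q))"
      unfolding divN by (simp add: sum.distrib sum_distrib_right)
    also have "\<dots> = N b f" unfolding w by (simp add: N_def Q_def algebra_simps)
    finally show ?thesis .
  qed
  have sumx: "sum (x (b, f)) UNIV = int (w b) + int (sum f UNIV) - int (N b f)" for b f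
  proof -
    have "int (N b f) = int (f None) + int (w b) + (\<Sum>i\<in>UNIV. int (q i * N b f div Q))"
      using arg_cong[OF key[of f b], of int] by simp
    then show ?thesis
      by (simp add: x_def sum_subtractf sum_UNIV_option)
  qed
  have memA: "(\<chi> i. real_of_int (y i)) \<in> A \<longleftrightarrow>
      sum y UNIV \<le> int t \<and> (\<forall>i. 0 \<le> y i * int Q + (int t - sum y UNIV) * int (q i))"
    for y :: "'n \<Rightarrow> int"
  proof -
    have "(\<chi> i. real_of_int (y i)) \<in> A \<longleftrightarrow>
      real_of_int (sum y UNIV) \<le> real_of_int (int t) \<and>
        (\<forall>i. 0 \<le> real_of_int (y i * int Q + (int t - sum y UNIV) * int (q i)))"
      unfolding A_def Int_iff
      by (subst dilated_Delta_1_iff) (auto simp: integer_points_def Q_def)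
    then show ?thesis unfolding of_int_le_iff of_int_0_le_iff .
  qed
  have N_eq: "int t - sum (x (b, f)) UNIV = int (N b f)" if "f \<in> F b" for b f
  proof -
    have "w b + sum f UNIV = t" using that by (simp add: F_def)
    then show ?thesis unfolding sumx by linarith
  qed
  have "bij_betw \<phi> (SIGMA b:{..<Q}. F b) A"
  proof (rule bij_betw_imageI)
    show "inj_on \<phi> (SIGMA b:{..<Q}. F b)"
    proof (rule inj_onI, clarify)
      fix b f b' f' assume 1: "b < Q" "f \<in> F b" "b' < Q" "f' \<in> F b'"
        and eq: "\<phi> (b, f) = \<phi> (b', f')"
      have xx: "x (b, f) = x (b', f')"
        using eq by (auto simp: \<phi>_def vec_eq_iff)
      then have NN: "N b f = N b' f'"
        using N_eq[of f b] N_eq[of f' b'] 1 by simp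
      have b: "b = b'"
        using arg_cong[OF NN, of "\<lambda>n. n mod Q"] 1 by (simp add: N_def)
      then have fN: "f None = f' None"
        using NN Q by (simp add: N_def)
      have fS: "f (Some i) = f' (Some i)" for i
        using fun_cong[OF xx, of i] NN by (simp add: x_def)
      have "f = f'"
        using fN fS by (intro ext) (metis option.exhaust)
      with b show "b = b' \<and> f = f'" by simp
    qed
    show "\<phi> ` (SIGMA b:{..<Q}. F b) = A"
    proof (intro equalityI subsetI)
      fix p assume "p \<in> \<phi> ` (SIGMA b:{..<Q}. F b)"
      then obtain b f where bf: "b < Q" "f \<in> F b" "p = \<phi> (b, f)" by auto
      have "0 \<le> x (b, f) i * int Q + int (N b f) * int (q i)" for i
      proof -
        have "int (q i * N b f div Q) * int Q \<le> int (N b f) * int (q i)"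
          using div_times_less_eq_dividend[of "q i * N b f" Q]
          by (simp add: mult.commute flip: of_nat_mult)
        moreover have "0 \<le> int (f (Some i)) * int Q" by simp
        moreover have "x (b, f) i * int Q =
            int (f (Some i)) * int Q - int (q i * N b f div Q) * int Q"
          by (simp add: x_def left_diff_distrib)
        ultimately show ?thesis by linarith
      qed
      then show "p \<in> A"
        unfolding bf(3) \<phi>_def memA N_eq[OF bf(2)] using N_eq[OF bf(2)] by auto
    next
      fix p assume p: "p \<in> A"
      define y where "y i = \<lfloor>p $ i\<rfloor>" for i
      have py: "p = (\<chi> i. real_of_int (y i))"
        using p by (auto simp: A_def integer_points_def y_def vec_eq_iff elim!: Ints_cases)
      have y1: "sum y UNIV \<le> int t"
        and y2: "\<And>i. 0 \<le> y i * int Q + (int t - sum y UNIV) * int (q i)"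
        using p unfolding py memA by auto
      define M where "M = nat (int t - sum y UNIV)"
      have M: "int M = int t - sum y UNIV" using y1 by (simp add: M_def)
      have nn: "0 \<le> y i + int (q i * M div Q)" for i
      proof -
        have "- y i * int Q \<le> int (q i * M)"
          using y2[of i] unfolding M[symmetric] by (simp add: mult.commute)
        then have "(- y i * int Q) div int Q \<le> int (q i * M) div int Q"
          using Q by (intro zdiv_mono1) auto
        moreover have "(- y i * int Q) div int Q = - y i"
          using Q by (intro nonzero_mult_div_cancel_right) simp
        ultimately show ?thesis unfolding zdiv_int by linarith
      qed
      define b where "b = M mod Q"
      define f :: "'n option \<Rightarrow> nat" where
        "f = case_option (M div Q) (\<lambda>i. nat (y i + int (q i * M div Q)))"
      have NM: "N b f = M" by (simp add: N_def b_def f_def)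
      have xy: "x (b, f) = y"
        using nn by (auto simp: x_def NM) (auto simp: f_def)
      have "int (w b + sum f UNIV) = int t"
        using sumx[of b f] M unfolding NM xy by linarith
      then have "f \<in> F b" unfolding F_def of_nat_eq_iff by simp
      moreover have "b < Q" using Q by (simp add: b_def)
      moreover have "p = \<phi> (b, f)" by (simp add: \<phi>_def xy py)
      ultimately show "p \<in> \<phi> ` (SIGMA b:{..<Q}. F b)" by auto
    qed
  qed
  then have "card A = card (SIGMA b:{..<Q}. F b)"
    by (metis bij_betw_same_card)
  also have cF: "card (F b) = (if w b \<le> t then (t - w b + CARD('n)) choose CARD('n) else 0)" for b
  proof (cases "w b \<le> t")
    case True
    then have "F b = {f. sum f UNIV = t - w b}" by (auto simp: F_def)
    then have "card (F b) = (t - w b + CARD('n)) choose (t - w b)"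
      by (simp add: card_functions_with_sum)
    also have "\<dots> = (t - w b + CARD('n)) choose CARD('n)"
      using binomial_symmetric[of "t - w b" "t - w b + CARD('n)"] by simp
    finally show ?thesis using True by simp
  qed (auto simp: F_def)
  have "card (SIGMA b:{..<Q}. F b) = (\<Sum>b<Q. card (F b))"
  proof (rule card_SigmaI)
    show "\<forall>b\<in>{..<Q}. finite (F b)"
    proof
      fix b
      have "F b \<subseteq> UNIV \<rightarrow>\<^sub>E {..t}"
        by (auto simp: F_def intro: order_trans[OF member_le_sum[of _ UNIV]])
      then show "finite (F b)"
        by (rule finite_subset) (auto intro!: finite_PiE)
    qed
  qed simp
  finally show ?thesis
    unfolding cF lattice_count_def A_def Q_def w_def .
qed

section \<open>Roots of the Ehrhart polynomial from roots of the h*-polynomial\<close>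

text \<open>
  Every root \<open>z\<close> of \<open>g\<close> is at least as close to \<open>t - 1\<close> as to \<open>t\<close>, because \<open>t - 1/2\<close> is not to the left
  of \<open>z\<close>; multiply over all roots.
\<close>

lemma norm_poly_shift_le:
  fixes g :: "complex poly"
  assumes roots: "\<And>z. poly g z = 0 \<Longrightarrow> Re z \<le> c" and t: "Re t \<ge> c + 1/2"
  shows "norm (poly g (t - 1)) \<le> norm (poly g t)"
  using roots
proof (induction "degree g" arbitrary: g)
  case 0
  then obtain a where "g = [:a:]" by (metis degree_eq_zeroE)
  then show ?case by simp
next
  case (Suc n)
  have "\<not> constant (poly g)" using Suc(2) by (simp add: constant_degree)
  then obtain z where z: "poly g z = 0" using fundamental_theorem_of_algebra by blast
  then obtain h where h: "g = [:- z, 1:] * h" by (metis dvdE poly_eq_0_iff_dvd)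
  have "h \<noteq> 0" using Suc(2) h by auto
  then have "degree g = Suc (degree h)" unfolding h by (subst degree_mult_eq) auto
  then have IH: "norm (poly h (t - 1)) \<le> norm (poly h t)"
    using Suc.hyps Suc.prems h by auto
  have "Re z \<le> c" using Suc.prems z by blast
  then have "(Re (t - 1 - z))\<^sup>2 \<le> (Re (t - z))\<^sup>2"
    using t by (simp flip: abs_le_square_iff)
  then have "norm (t - 1 - z) \<le> norm (t - z)"
    by (simp add: cmod_def)
  then show ?case
    using IH unfolding h poly_mult norm_mult by (intro mult_mono) auto
qed

text \<open>
  This is \<open>d!\<close> times \<open>\<Sum>\<^sub>j h\<^sub>j binom(t + d - j, d)\<close>, where the \<open>h\<^sub>j\<close> are the coefficients of \<open>H\<close>.
\<close>

definition binomial_transform :: "nat \<Rightarrow> complex poly \<Rightarrow> complex \<Rightarrow> complex" where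
  "binomial_transform d H t = (\<Sum>j\<le>degree H. coeff H j * pochhammer (t - of_nat j + 1) d)"

lemma binomial_transform_altdef:
  assumes "degree H \<le> n"
  shows "binomial_transform d H t = (\<Sum>j\<le>n. coeff H j * pochhammer (t - of_nat j + 1) d)"
  unfolding binomial_transform_def
  by (rule sum.mono_neutral_left) (use assms in \<open>auto simp: coeff_eq_0\<close>)

text \<open>
  Multiplying \<open>H\<close> by the variable shifts the argument of the transform by one.
\<close>

lemma binomial_transform_linear_factor:
  "binomial_transform d ([:- a, 1:] * H) t =
     binomial_transform d H (t - 1) - a * binomial_transform d H t"
proof -
  have deg: "degree ([:- a, 1:] * H) \<le> Suc (degree H)"
    by (rule order_trans[OF degree_mult_le]) simp
  have c: "coeff ([:- a, 1:] * H) j = coeff (pCons 0 H) j - a * coeff H j" for j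
    by simp
  have "binomial_transform d ([:- a, 1:] * H) t =
      (\<Sum>j\<le>Suc (degree H). coeff (pCons 0 H) j * pochhammer (t - of_nat j + 1) d)
      - a * (\<Sum>j\<le>Suc (degree H). coeff H j * pochhammer (t - of_nat j + 1) d)"
    unfolding binomial_transform_altdef[OF deg] c
    by (simp add: sum_subtractf sum_distrib_left algebra_simps del: sum.atMost_Suc mult_pCons_left)
  also have "(\<Sum>j\<le>Suc (degree H). coeff H j * pochhammer (t - of_nat j + 1) d)
      = binomial_transform d H t"
    by (rule binomial_transform_altdef[symmetric]) simp
  also have "(\<Sum>j\<le>Suc (degree H). coeff (pCons 0 H) j * pochhammer (t - of_nat j + 1) d)
      = binomial_transform d H (t - 1)"
    by (subst sum.atMost_Suc_shift) (simp add: binomial_transform_def algebra_simps)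
  finally show ?thesis .
qed

text \<open>
  Induction on the degree of \<open>H\<close>. If \<open>H = (z - a) K\<close> and \<open>n = d - degree H\<close>, then the transform of
  \<open>K\<close> is \<open>(t + 1) \<cdots> (t + n + 1) g(t)\<close>, and the transform of \<open>H\<close> is
  \<open>(t + 1) \<cdots> (t + n) G(t)\<close> with \<open>G(t) = t g(t - 1) - a (t + n + 1) g(t)\<close>. To the right of the
  line \<open>Re t = -(n + 1)/2\<close> one has \<open>\<bar>t\<bar> < \<bar>t + n + 1\<bar>\<close>, and \<open>\<bar>g(t - 1)\<bar> \<le> \<bar>g(t)\<bar> \<noteq> 0\<close> because the roots of
  \<open>g\<close> have real part at most \<open>-(n + 2)/2\<close>. With \<open>\<bar>a\<bar> \<ge> 1\<close> the second term of \<open>G\<close> dominates.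
\<close>

lemma binomial_transform_factorization:
  assumes "degree H \<le> d" and "\<And>z. poly H z = 0 \<Longrightarrow> norm z \<ge> 1"
  shows "\<exists>g. (\<forall>t. binomial_transform d H t = pochhammer (t + 1) (d - degree H) * poly g t) \<and>
             (\<forall>t. poly g t = 0 \<longrightarrow> Re t \<le> - (real (d - degree H) + 1) / 2)"
  using assms
proof (induction "degree H" arbitrary: H)
  case 0
  then obtain c where c: "H = [:c:]" by (metis degree_eq_zeroE)
  have "c \<noteq> 0" using "0.prems"(2)[of 0] by (auto simp: c)
  then show ?case
    by (intro exI[of _ "[:c:]"]) (simp add: binomial_transform_def c)
next
  case (Suc e)
  have "\<not> constant (poly H)" using Suc(2) by (simp add: constant_degree)
  then obtain a where a: "poly H a = 0" using fundamental_theorem_of_algebra by blast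
  then obtain K where K: "H = [:- a, 1:] * K" by (metis dvdE poly_eq_0_iff_dvd)
  have "K \<noteq> 0" using Suc(2) K by auto
  then have degH: "degree H = Suc (degree K)" unfolding K by (subst degree_mult_eq) auto
  define n where "n = d - degree H"
  have n: "d - degree K = Suc n" using degH Suc.prems(1) by (simp add: n_def)
  have "poly K z = 0 \<Longrightarrow> norm z \<ge> 1" for z using Suc.prems(2)[of z] by (simp add: K)
  then obtain g where g: "\<And>t. binomial_transform d K t = pochhammer (t + 1) (Suc n) * poly g t"
    and roots: "\<And>t. poly g t = 0 \<Longrightarrow> Re t \<le> - (real (Suc n) + 1) / 2"
    using Suc.hyps(1)[of K] degH Suc.hyps(2) Suc.prems(1) n by auto
  define G where "G = [:0, 1:] * pcompose g [:- 1, 1:] - smult a ([:of_nat (Suc n), 1:] * g)"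
  have G: "poly G t = t * poly g (t - 1) - a * ((t + of_nat (Suc n)) * poly g t)" for t
    by (simp add: G_def poly_pcompose algebra_simps)
  have "binomial_transform d H t = pochhammer (t + 1) n * poly G t" for t
  proof -
    have "pochhammer (t + 1) (Suc n) = (t + of_nat (Suc n)) * pochhammer (t + 1) n"
      unfolding pochhammer_rec' by (simp add: algebra_simps)
    moreover have "pochhammer (t - 1 + 1) (Suc n) = t * pochhammer (t + 1) n"
      unfolding pochhammer_rec by simp
    ultimately show ?thesis
      unfolding K binomial_transform_linear_factor g G by (simp add: algebra_simps)
  qed
  moreover have "Re t \<le> - (real n + 1) / 2" if "poly G t = 0" for t
  proof (rule ccontr)
    assume "\<not> Re t \<le> - (real n + 1) / 2"
    then have t: "Re t > - (real n + 1) / 2" by simp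
    have gt: "poly g t \<noteq> 0" using roots[of t] t by (auto simp: field_simps)
    have "norm (poly g (t - 1)) \<le> norm (poly g t)"
      using roots t by (intro norm_poly_shift_le[where c = "- (real (Suc n) + 1) / 2"])
         (auto simp: field_simps)
    then have "norm (t * poly g (t - 1)) \<le> norm t * norm (poly g t)"
      by (simp add: norm_mult mult_left_mono)
    also have "\<bar>Re t\<bar> < \<bar>Re t + real (Suc n)\<bar>" using t by (auto simp: abs_if)
    then have "(Re t)\<^sup>2 < (Re t + real (Suc n))\<^sup>2"
      by (metis abs_ge_zero power2_abs power_strict_mono pos2)
    then have "norm t < norm (t + of_nat (Suc n))"
      by (simp add: cmod_def)
    then have "norm t * norm (poly g t) < norm (t + of_nat (Suc n)) * norm (poly g t)"
      using gt by (intro mult_strict_right_mono) auto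
    also have "\<dots> = 1 * norm ((t + of_nat (Suc n)) * poly g t)" by (simp add: norm_mult)
    also have "\<dots> \<le> norm a * norm ((t + of_nat (Suc n)) * poly g t)"
      using Suc.prems(2)[OF a] by (intro mult_right_mono) auto
    also have "\<dots> = norm (t * poly g (t - 1))"
      using that by (simp add: G norm_mult)
    finally show False by simp
  qed
  ultimately show ?case
    unfolding n_def[symmetric] by (intro exI[of _ G]) auto
qed

lemma binomial_transform_nonzero:
  assumes "degree H \<le> d" and "\<And>z. poly H z = 0 \<Longrightarrow> norm z \<ge> 1" and t: "Re t \<ge> 0"
  shows "binomial_transform d H t \<noteq> 0"
proof -
  obtain g where g: "binomial_transform d H t = pochhammer (t + 1) (d - degree H) * poly g t"
    and roots: "poly g t = 0 \<longrightarrow> Re t \<le> - (real (d - degree H) + 1) / 2"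
    using binomial_transform_factorization[OF assms(1,2)] by blast
  have "poly g t \<noteq> 0"
  proof
    assume "poly g t = 0"
    with roots have "Re t \<le> - (real (d - degree H) + 1) / 2" by blast
    also have "\<dots> < 0" by simp
    finally show False using t by simp
  qed
  moreover have "pochhammer (t + 1) (d - degree H) \<noteq> 0"
  proof
    assume "pochhammer (t + 1) (d - degree H) = 0"
    then obtain k where "t + 1 = - of_nat k" by (auto simp: pochhammer_eq_0_iff)
    then have "Re (t + 1) = Re (- of_nat k)" by simp
    then show False using t by simp
  qed
  ultimately show ?thesis unfolding g by simp
qed

section \<open>Real polynomials with all roots in the left half-plane\<close>

lemma coeff_mult_pos:
  fixes p q :: "real poly"
  assumes "\<And>i. i \<le> degree p \<Longrightarrow> coeff p i > 0" "\<And>i. i \<le> degree q \<Longrightarrow> coeff q i > 0"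
    and i: "i \<le> degree p + degree q"
  shows "coeff (p * q) i > 0"
proof -
  have nn: "coeff p j \<ge> 0" "coeff q j \<ge> 0" for j
    using assms(1,2)[of j] by (cases "j \<le> degree p"; cases "j \<le> degree q"; force simp: coeff_eq_0 not_le)+
  \<comment> \<open>The index \<open>j\<close> makes both \<open>coeff p j\<close> and \<open>coeff q (i - j)\<close> positive, as \<open>i - j \<le> degree q\<close>.\<close>
  define j where "j = min i (degree p)"
  have "0 < coeff p j * coeff q (i - j)"
    using assms by (intro mult_pos_pos) (auto simp: j_def)
  also have "\<dots> \<le> (\<Sum>j\<le>i. coeff p j * coeff q (i - j))"
    by (rule member_le_sum) (auto simp: nn j_def)
  finally show ?thesis by (simp add: coeff_mult)
qed

text \<open>
  Strong induction on the degree: a real root \<open>z\<close> splits off the factor \<open>x - z\<close>, a non-real one the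
  factor \<open>x\<^sup>2 - 2 Re(z) x + \<bar>z\<bar>\<^sup>2\<close>. Both have only positive coefficients as \<open>Re z < 0\<close>.
\<close>

lemma coeff_pos_if_roots_in_left_half_plane:
  fixes p :: "real poly"
  assumes "lead_coeff p > 0"
    and "\<And>z::complex. poly (map_poly of_real p) z = 0 \<Longrightarrow> Re z < 0"
    and "i \<le> degree p"
  shows "coeff p i > 0"
  using assms
proof (induction "degree p" arbitrary: p i rule: less_induct)
  case less
  let ?c = "map_poly of_real :: real poly \<Rightarrow> complex poly"
  have hom: "?c (q * r) = ?c q * ?c r" for q r
    by (rule poly_eqI) (simp add: coeff_map_poly coeff_mult)
  have quotient: ?case if f: "p = q * f" "degree f > 0" "\<And>i. i \<le> degree f \<Longrightarrow> coeff f i > 0"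
    for q f
  proof -
    have "q \<noteq> 0" "f \<noteq> 0" using less.prems(1) f by auto
    then have deg: "degree p = degree q + degree f" using f by (simp add: degree_mult_eq)
    have "lead_coeff f > 0" using f(3) by simp
    then have "lead_coeff q > 0"
      using less.prems(1) by (simp add: f(1) lead_coeff_mult zero_less_mult_iff)
    moreover have "poly (?c q) z = 0 \<Longrightarrow> Re z < 0" for z
      using less.prems(2)[of z] by (simp add: f(1) hom)
    ultimately have "coeff q i > 0" if "i \<le> degree q" for i
      using less.hyps[of q] deg f(2) that by simp
    then show ?thesis
      unfolding f(1) by (rule coeff_mult_pos) (use f(3) less.prems(3) deg in auto)
  qed
  show ?case
  proof (cases "degree p = 0")
    case True
    then show ?thesis using less.prems by simp
  next
    case False
    have "degree (?c p) = degree p" by (simp add: degree_map_poly)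
    then have "\<not> constant (poly (?c p))" using False by (simp add: constant_degree)
    then obtain z where z: "poly (?c p) z = 0" using fundamental_theorem_of_algebra by blast
    have Rez: "Re z < 0" using less.prems(2) z by blast
    show ?thesis
    proof (cases "Im z = 0")
      case True
      then have zr: "z = of_real (Re z)" by (simp add: complex_eq_iff)
      have "poly (?c p) (of_real (Re z)) = of_real (poly p (Re z))"
        by (simp add: poly_altdef degree_map_poly coeff_map_poly)
      then have "poly p (Re z) = 0" using z zr by (metis of_real_eq_0_iff)
      then obtain q where "p = q * [:- Re z, 1:]"
        by (metis dvdE mult.commute poly_eq_0_iff_dvd)
      then show ?thesis
        by (rule quotient) (use Rez in \<open>auto simp: coeff_pCons split: nat.split\<close>)
    next
      case False
      define f where "f = [:(Re z)\<^sup>2 + (Im z)\<^sup>2, - 2 * Re z, 1:]"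
      have fz: "poly (?c f) z = 0"
        by (simp add: f_def map_poly_pCons complex_eq_iff power2_eq_square algebra_simps)
      have "f \<noteq> 0" by (simp add: f_def)
      have "degree f = 2" by (simp add: f_def)
      define r where "r = p mod f"
      have pr: "p = p div f * f + r" by (simp add: r_def)
      have "degree r < 2"
        using degree_mod_less[OF \<open>f \<noteq> 0\<close>, of p] \<open>degree f = 2\<close> by (auto simp: r_def)
      then have "degree r \<le> 1" by simp
      have add: "?c (q + s) = ?c q + ?c s" for q s
        by (rule poly_eqI) (simp add: coeff_map_poly)
      have "poly (?c p) z = poly (?c (p div f)) z * poly (?c f) z + poly (?c r) z"
        by (subst pr) (simp add: add hom)
      then have "poly (?c r) z = 0" using z fz by simp
      moreover obtain u v where r: "r = [:u, v:]"
      proof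
        show "r = [:coeff r 0, coeff r 1:]"
          using \<open>degree r \<le> 1\<close>
          by (intro poly_eqI) (auto simp: coeff_pCons coeff_eq_0 split: nat.split)
      qed
      ultimately have "of_real u + z * of_real v = 0"
        by (simp add: map_poly_pCons)
      \<comment> \<open>A real polynomial of degree at most one is zero if it has a non-real root.\<close>
      then have "v = 0" "u = 0" using False by (auto simp: complex_eq_iff)
      then have "r = 0" using r by simp
      then have "p = p div f * f" using pr by simp
      then show ?thesis
      proof (rule quotient)
        show "coeff f i > 0" if "i \<le> degree f" for i
        proof -
          have "i = 0 \<or> i = 1 \<or> i = 2" using that \<open>degree f = 2\<close> by auto
          moreover have "(Re z)\<^sup>2 + (Im z)\<^sup>2 > 0"
            using Rez by (simp add: sum_power2_gt_zero_iff)
          ultimately show ?thesis using Rez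
            by (auto simp: f_def coeff_pCons)
        qed
      qed (simp add: \<open>degree f = 2\<close>)
    qed
  qed
qed

section \<open>Ehrhart positivity from the h*-polynomial\<close>

lemma poly_pochhammer: "poly (pochhammer p n) x = pochhammer (poly p x) n"
  by (induction n) (simp_all add: pochhammer_Suc)

lemma monic_pochhammer:
  fixes c :: real
  shows "degree (pochhammer [:c, 1:] n) = n \<and> coeff (pochhammer [:c, 1:] n) n = 1"
proof (induction n)
  case (Suc n)
  have e: "pochhammer [:c, 1:] (Suc n) = pochhammer [:c, 1:] n * [:c + of_nat n, 1:]"
    by (simp add: pochhammer_Suc of_nat_poly)
  have "pochhammer [:c, 1:] n \<noteq> 0" using Suc by auto
  then have d: "degree (pochhammer [:c, 1:] (Suc n)) = Suc n"
    unfolding e using Suc by (subst degree_mult_eq) auto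
  have "lead_coeff (pochhammer [:c, 1:] (Suc n)) = 1"
    unfolding e lead_coeff_mult using Suc by simp
  with d show ?case by simp
qed simp

text \<open>
  For \<open>t < w\<close> the polynomial \<open>binom(t + d - w, d)\<close> vanishes, since \<open>w \<le> d\<close> puts zero among the
  factors of the rising factorial. This is what makes the lattice point count polynomial in \<open>t\<close>.
\<close>

lemma pochhammer_eq_choose:
  assumes "w \<le> d"
  shows "pochhammer (real t - real w + 1) d / fact d =
           (if w \<le> t then real ((t - w + d) choose d) else 0)"
proof (cases "w \<le> t")
  case True
  then show ?thesis
    by (simp add: binomial_gbinomial gbinomial_pochhammer' of_nat_diff algebra_simps)
next
  case False
  then have "pochhammer (real t - real w + 1) d = 0"
    unfolding pochhammer_eq_0_iff using assms
    by (intro exI[of _ "w - t - 1"]) (auto simp: of_nat_diff)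
  then show ?thesis using False by simp
qed

text \<open>
  The Ehrhart polynomial is the transform of the \<open>h*\<close>-polynomial divided by \<open>d!\<close>; its
  leading coefficient is \<open>Q / d!\<close>, where \<open>Q = 1 + \<Sum>q\<close> is the number of terms \<open>b\<close>.
\<close>

lemma Delta_1_ehrhart_positive:
  fixes q :: "'n::finite \<Rightarrow> nat"
  assumes roots: "\<And>z::complex. (\<Sum>b<1 + sum q UNIV. z ^ hstar_exponent q b) = 0 \<Longrightarrow> norm z \<ge> 1"
  shows "ehrhart_positive (Delta_1 (\<chi> i. real (q i)))"
proof -
  define d where "d = CARD('n)"
  define Q where "Q = 1 + sum q UNIV"
  define w where "w = hstar_exponent q"
  have w: "w b \<le> d" if "b < Q" for b
    using hstar_exponent_le[of b q] that by (simp add: w_def Q_def d_def)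
  define H :: "complex poly" where "H = (\<Sum>b<Q. monom 1 (w b))"
  define L :: "real poly" where
    "L = smult (1 / fact d) (\<Sum>b<Q. pochhammer [:1 - real (w b), 1:] d)"
  have degH: "degree H \<le> d"
    unfolding H_def using w by (intro degree_sum_le) (auto intro: order_trans[OF degree_monom_le])
  have Hz: "norm z \<ge> 1" if "poly H z = 0" for z
    using that by (intro roots) (simp add: H_def poly_sum poly_monom Q_def w_def)
  have bt: "binomial_transform d H z = (\<Sum>b<Q. pochhammer (z - of_nat (w b) + 1) d)" for z
  proof -
    have "binomial_transform d H z =
        (\<Sum>j\<le>d. \<Sum>b<Q. if w b = j then pochhammer (z - of_nat j + 1) d else 0)"
      unfolding binomial_transform_altdef[OF degH]
      by (simp add: H_def coeff_sum sum_distrib_right if_distrib[of "\<lambda>x. x * _"] cong: if_cong)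
    also have "\<dots> = (\<Sum>b<Q. \<Sum>j\<le>d. if w b = j then pochhammer (z - of_nat j + 1) d else 0)"
      by (rule sum.swap)
    also have "\<dots> = (\<Sum>b<Q. pochhammer (z - of_nat (w b) + 1) d)"
      using w by (intro sum.cong) auto
    finally show ?thesis .
  qed
  have Lz: "poly (map_poly of_real L) z = binomial_transform d H z / fact d" for z :: complex
  proof -
    let ?c = "map_poly of_real :: real poly \<Rightarrow> complex poly"
    have sum_hom: "?c (\<Sum>b<Q. f b) = (\<Sum>b<Q. ?c (f b))" for f
      by (rule poly_eqI) (simp add: coeff_map_poly coeff_sum)
    have mult_hom: "?c (p * r) = ?c p * ?c r" for p r
      by (rule poly_eqI) (simp add: coeff_map_poly coeff_mult)
    have poch: "?c (pochhammer [:a, 1:] n) = pochhammer [:of_real a, 1:] n" for a n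
      by (induction n)
         (simp_all add: pochhammer_Suc mult_hom of_nat_poly map_poly_pCons del: mult_pCons_right)
    have "?c L = smult (1 / fact d) (\<Sum>b<Q. pochhammer [:1 - of_nat (w b), 1:] d)"
      by (simp add: L_def map_poly_smult sum_hom poch)
    then show ?thesis
      by (simp add: bt poly_sum poly_pochhammer algebra_simps)
  qed
  have coeffL: "coeff L d = real Q / fact d"
    using monic_pochhammer[of _ d] by (simp add: L_def coeff_sum)
  have Q: "Q > 0" by (simp add: Q_def)
  have "degree L \<le> d"
    unfolding L_def using monic_pochhammer[of _ d]
    by (intro order_trans[OF degree_smult_le] degree_sum_le) auto
  moreover have "coeff L d \<noteq> 0" using coeffL Q by simp
  ultimately have degL: "degree L = d" by (intro antisym le_degree)
  have "lead_coeff L > 0" using coeffL Q by (simp add: degL)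
  moreover have "Re z < 0" if "poly (map_poly of_real L) z = 0" for z :: complex
    using binomial_transform_nonzero[OF degH Hz, of z] that by (fastforce simp: Lz)
  ultimately have pos: "\<forall>i\<le>degree L. coeff L i > 0"
    using coeff_pos_if_roots_in_left_half_plane by blast
  have "poly L (real t) = real (lattice_count (Delta_1 (\<chi> i. real (q i))) t)" for t
  proof -
    have "poly L (real t) = (\<Sum>b<Q. pochhammer (real t - real (w b) + 1) d / fact d)"
      by (simp add: L_def poly_sum poly_pochhammer sum_divide_distrib algebra_simps)
    also have "\<dots> = (\<Sum>b<Q. real (if w b \<le> t then (t - w b + d) choose d else 0))"
      using w by (intro sum.cong) (simp_all add: pochhammer_eq_choose)
    finally show ?thesis
      unfolding lattice_count_Delta_1 Q_def w_def d_def of_nat_sum .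
  qed
  moreover have "int (degree L) = aff_dim (Delta_1 (\<chi> i. real (q i)))"
    using aff_dim_simplex[OF Delta_1_simplex[of "\<chi> i. real (q i)"]] by (simp add: degL d_def)
  ultimately have "is_ehrhart_polynomial (Delta_1 (\<chi> i. real (q i))) L"
    by (simp add: is_ehrhart_polynomial_def)
  with pos show ?thesis unfolding ehrhart_positive_def by blast
qed

section \<open>The weights 1 and s\<close>

lemma sum_weights:
  fixes pos :: "'n::finite \<Rightarrow> nat"
  assumes "bij_betw pos UNIV {..<length (weights r s k)}"
  shows "(\<Sum>i\<in>UNIV. g (weights r s k ! pos i)) = (s * k - 1) * g 1 + (r + 1) * (g s :: nat)"
proof -
  have "(\<Sum>i\<in>UNIV. g (weights r s k ! pos i)) = (\<Sum>j<length (weights r s k). g (weights r s k ! j))"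
    using assms by (rule sum.reindex_bij_betw)
  also have "\<dots> = sum_list (map g (weights r s k))"
    by (simp add: sum_list_sum_nth atLeast0LessThan)
  also have "\<dots> = (s * k - 1) * g 1 + (r + 1) * g s"
    by (simp add: weights_def sum_list_replicate)
  finally show ?thesis .
qed

lemma norm_eq_1_if_geometric_sum_eq_0:
  fixes z :: complex
  assumes "n > 0" and "(\<Sum>i<n. z ^ i) = 0"
  shows "norm z = 1"
proof -
  have "1 - z ^ n = (1 - z) * (\<Sum>i<n. z ^ i)" by (rule one_diff_power_eq)
  then have "z ^ n = 1" using assms by simp
  then show ?thesis using power_eq_1_iff[of z n] \<open>n > 0\<close> by auto
qed

text \<open>
  With \<open>b = a m + c\<close>, \<open>c < m = k + r + 1\<close> and \<open>a < s\<close>, each weight \<open>1\<close> contributes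
  \<open>floor(b / (s m)) = 0\<close> to the exponent and each of the \<open>r + 1\<close> weights \<open>s\<close> contributes
  \<open>floor(b / m) = a\<close>, so the exponent is \<open>m a + c - (r + 1) a = k a + c\<close>.
\<close>

lemma hstar_weights:
  fixes pos :: "'n::finite \<Rightarrow> nat" and r s k :: nat
  defines "q \<equiv> \<lambda>i. weights r s k ! pos i"
  assumes sk: "s > 0" "k > 0" and pos: "bij_betw pos UNIV {..<length (weights r s k)}"
  shows "(\<Sum>b<1 + sum q UNIV. z ^ hstar_exponent q b) =
    (\<Sum>a<s. (z ^ k) ^ a) * (\<Sum>c<k + r + 1. (z :: complex) ^ c)"
proof -
  define m where "m = k + r + 1"
  have "s * k > 0" using sk by simp
  then have Q: "1 + sum q UNIV = s * m"
    using sum_weights[OF pos, of "\<lambda>x. x"] by (simp add: q_def m_def algebra_simps)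
  have exponent: "hstar_exponent q (c + a * m) = k * a + c" if "a < s" "c < m" for a c
  proof -
    have "c + a * m < Suc a * m" using that by simp
    also have "\<dots> \<le> s * m" using that by (intro mult_right_mono) auto
    finally have lt: "c + a * m < s * m" .
    have div: "(c + a * m) div m = a" using that by simp
    have "(\<Sum>i\<in>UNIV. q i * (c + a * m) div (s * m)) =
        (s * k - 1) * (1 * (c + a * m) div (s * m)) + (r + 1) * (s * (c + a * m) div (s * m))"
      unfolding q_def by (rule sum_weights[OF pos])
    also have "\<dots> = (r + 1) * a"
      using lt sk div by (simp del: One_nat_def)
    finally show ?thesis
      unfolding hstar_exponent_def Q by (simp add: m_def algebra_simps)
  qed
  have "(\<Sum>b<s * m. z ^ hstar_exponent q b) = (\<Sum>a<s. \<Sum>b\<in>{a * m..<a * m + m}. z ^ hstar_exponent q b)"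
    by (rule sum.nat_group[symmetric])
  also have "\<dots> = (\<Sum>a<s. \<Sum>c<m. z ^ hstar_exponent q (c + a * m))"
  proof (rule sum.cong[OF refl])
    fix a
    show "(\<Sum>b\<in>{a * m..<a * m + m}. z ^ hstar_exponent q b) = (\<Sum>c<m. z ^ hstar_exponent q (c + a * m))"
      using sum.shift_bounds_nat_ivl[of "\<lambda>b. z ^ hstar_exponent q b" 0 "a * m" m]
      unfolding add_0 add.commute[of m "a * m"] atLeast0LessThan .
  qed
  also have "\<dots> = (\<Sum>a<s. \<Sum>c<m. (z ^ k) ^ a * z ^ c)"
    by (intro sum.cong refl) (simp add: exponent power_add power_mult)
  also have "\<dots> = (\<Sum>a<s. (z ^ k) ^ a) * (\<Sum>c<m. z ^ c)"
    by (rule sum_product[symmetric])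
  finally show ?thesis unfolding Q m_def .
qed

theorem theorem3p2:
  fixes r s k d :: nat
    and pos :: "'n::finite \<Rightarrow> nat"
    and q :: "real ^ 'n"
  assumes "s \<ge> 3" and "k \<ge> r + 2"
    and "d = s * k + r"
    and "CARD('n) = d"
    and "bij_betw pos UNIV {..<d}"
    and "q = vec_of_list_along pos (weights r s k)"
  shows "lattice_polytope (Delta_1 q) \<and> int d simplex Delta_1 q \<and> ehrhart_positive (Delta_1 q)"
proof (intro conjI)
  define qn where "qn = (\<lambda>i. weights r s k ! pos i)"
  have q: "q = (\<chi> i. real (qn i))"
    by (simp add: assms(6) vec_of_list_along_def qn_def)
  have sk: "s > 0" "k > 0" "s * k > 0" using assms(1,2) by auto
  then have "length (weights r s k) = d"
    by (simp add: weights_def assms(3))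
  then have pos: "bij_betw pos UNIV {..<length (weights r s k)}"
    using assms(5) by simp
  show "lattice_polytope (Delta_1 q)"
    unfolding lattice_polytope_def Delta_1_def
    by (intro exI[of _ "range (\<lambda>i. axis i 1) \<union> {- q}"])
       (auto simp: integer_points_def axis_def q)
  show "int d simplex Delta_1 q"
    using Delta_1_simplex[of q] by (simp add: q assms(4))
  show "ehrhart_positive (Delta_1 q)"
    unfolding q
  proof (rule Delta_1_ehrhart_positive)
    fix z :: complex
    assume "(\<Sum>b<1 + sum qn UNIV. z ^ hstar_exponent qn b) = 0"
    then have "(\<Sum>a<s. (z ^ k) ^ a) = 0 \<or> (\<Sum>c<k + r + 1. z ^ c) = 0"
      unfolding qn_def hstar_weights[OF sk(1,2) pos] by simp
    then have "norm (z ^ k) = 1 \<or> norm z = 1"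
      using norm_eq_1_if_geometric_sum_eq_0[of s "z ^ k"] norm_eq_1_if_geometric_sum_eq_0[of "k + r + 1" z] sk(1)
      by auto
    then show "norm z \<ge> 1"
      using sk(2) power_eq_1_iff[of "norm z" k] by (auto simp: norm_power)
  qed
qed

end
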